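(* Let $D$ be a reduced knot diagram. If $x\in\widetilde{X}(D)$ is a perfect and admissible matching, then each connected component of the black and white orthogonal subgraphs $H_x^b\subset G_b$ and $H_x^w\subset G_w$ it induces is either a tree or has the homotopy type of a circle. Furthermore, there is exactly one tree of each colour.
   Context: Setting. $D$ is (the projection of) a knot diagram with at least one crossing, viewed as a connected 4-valent graph on $S^2$, with a chequerboard black/white colouring of the regions. $D$ is reduced if it has no nugatory crossing, i.e. no crossing has the same region at two of its four corners. The black graph $G_b$ has the black regions as vertices and one edge for each crossing, joining the two black regions opposite each other at that crossing; the white graph $G_w$ is defined analogously and is the plane dual of $G_b$. The overlaid Tait graph $\Gamma(D)$ is the superimposition of $G_b$ and $G_w$ on $S^2$: its vertices are the black regions, the white regions and the crossings, and its edges are the half-edges of $G_b$ and $G_w$, each joining a region to an incident crossing. $\widetilde X(D)$ is the set of partial Kauffman states: injections from a subset of the crossings to the set of regions, pairing each crossing in the subset with one of its four adjacent regions; equivalently, matchings on $\Gamma(D)$. A matching is perfect here if every crossing is matched (so exactly two regions are unmatched); a perfect matching is admissible if exactly one black and one white region are unmatched. $H_x^b$ is the spanning subgraph of $G_b$ (all black regions as vertices) whose edges correspond to the crossings matched by $x$ with a black region; $H_x^w$ is the spanning subgraph of $G_w$ whose edges correspond to the crossings matched with a white region. Single vertices count as trees. *)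

theory Defs
  imports
    "HOL-Analysis.Analysis"
    "HOL-Combinatorics.Orbits"
    "Graph_Theory.Digraph_Component"
begin

section \<open>Knot projections\<close>

text \<open>
  A connected 4-valent graph on the sphere is represented, up to orientation preserving
  homeomorphism of the sphere, by its rotation system. A dart is an edge together with one of
  its two ends; \<open>rot\<close> sends a dart to the next dart counterclockwise around
  the same crossing and \<open>opp\<close> sends a dart to the other end of the same edge. The
  field \<open>black\<close> is the set of black regions.
\<close>

record 'd diagram =
  darts :: "'d set"
  rot :: "'d \<Rightarrow> 'd"
  opp :: "'d \<Rightarrow> 'd"
  black :: "'d set set"

definition crossing :: "'d diagram \<Rightarrow> 'd \<Rightarrow> 'd set" where
  "crossing D d = orbit (rot D) d"

definition crossings :: "'d diagram \<Rightarrow> 'd set set" where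
  "crossings D = crossing D ` darts D"

definition edges :: "'d diagram \<Rightarrow> 'd set set" where
  "edges D = (\<lambda>d. {d, opp D d}) ` darts D"

text \<open>
  A dart also names a corner of a crossing, namely the one between the darts \<open>d\<close>
  and \<open>rot D d\<close>. It lies to the left of \<open>d\<close>, seen from the crossing. Walking
  along \<open>d\<close> with this region on the left, the next dart of the boundary walk is
  the one preceding \<open>opp D d\<close> in the rotation, so a region is identified with the orbit
  consisting of its corners.
\<close>

definition region :: "'d diagram \<Rightarrow> 'd \<Rightarrow> 'd set" where
  "region D d = orbit (inv (rot D) \<circ> opp D) d"

definition regions :: "'d diagram \<Rightarrow> 'd set set" where
  "regions D = region D ` darts D"

definition white :: "'d diagram \<Rightarrow> 'd set set" where
  "white D = regions D - black D"

locale plane_four_valent_graph =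
  fixes D :: "'d diagram" (structure)
  assumes finite_darts: "finite (darts D)"
    and darts_nonempty: "darts D \<noteq> {}"
    and rot_permutes: "rot D permutes darts D"
    and four_valent: "d \<in> darts D \<Longrightarrow> card (crossing D d) = 4"
    and opp_permutes: "opp D permutes darts D"
    and opp_neq: "d \<in> darts D \<Longrightarrow> opp D d \<noteq> d"
    and opp_opp: "d \<in> darts D \<Longrightarrow> opp D (opp D d) = d"
    and connected_graph: "\<lbrakk>d \<in> darts D; e \<in> darts D\<rbrakk> \<Longrightarrow>
      (d, e) \<in> ({(a, rot D a) | a. a \<in> darts D} \<union> {(a, opp D a) | a. a \<in> darts D})\<^sup>*"
    and euler_sphere: "card (crossings D) + card (regions D) = card (edges D) + 2"

text \<open>
  Each edge \<open>d\<close> separates the region on its left, \<open>region D d\<close>, from that on its right,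
  which is \<open>region D (opp D d)\<close>. A strand passes straight through a crossing from
  \<open>d\<close> to \<open>rot D (rot D d)\<close>, and the diagram is that of a knot (rather than
  of a link) if all darts lie on one strand.
\<close>

locale knot_diagram = plane_four_valent_graph +
  assumes black_subset: "black D \<subseteq> regions D"
    and chequerboard: "d \<in> darts D \<Longrightarrow> region D d \<in> black D \<longleftrightarrow> region D (opp D d) \<notin> black D"
    and one_component: "\<lbrakk>d \<in> darts D; e \<in> darts D\<rbrakk> \<Longrightarrow>
      (d, e) \<in> ({(a, rot D (rot D a)) | a. a \<in> darts D} \<union> {(a, opp D a) | a. a \<in> darts D})\<^sup>*"

definition reduced_diagram :: "'d diagram \<Rightarrow> bool" where
  "reduced_diagram D \<longleftrightarrow> (\<forall>c \<in> crossings D. inj_on (region D) c)"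


section \<open>Tait graphs\<close>

text \<open>
  The regions of one colour, \<open>S = black D\<close> or \<open>S = white D\<close>, are the vertices of a
  multigraph with one edge for each crossing. As usual for bidirected graphs,
  an undirected edge is a pair of mutually reverse arcs. Here these are the two corners of the
  crossing with colour \<open>S\<close>, directed from the region at that corner to the
  region at the opposite corner, so the arcs correspond to the half-edges of the Tait graph.
\<close>

definition opposite_corner :: "'d diagram \<Rightarrow> 'd \<Rightarrow> 'd" where
  "opposite_corner D d = rot D (rot D d)"

definition tait_graph :: "'d diagram \<Rightarrow> 'd set set \<Rightarrow> ('d set, 'd) pre_digraph" where
  "tait_graph D S = \<lparr> verts = S, arcs = {d \<in> darts D. region D d \<in> S},
     tail = region D, head = region D \<circ> opposite_corner D \<rparr>"


section \<open>Partial Kauffman states\<close>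

definition partial_states :: "'d diagram \<Rightarrow> ('d set \<rightharpoonup> 'd set) set" where
  "partial_states D = {x. dom x \<subseteq> crossings D \<and> inj_on x (dom x) \<and>
     (\<forall>c r. x c = Some r \<longrightarrow> (\<exists>d \<in> c. r = region D d))}"

definition perfect_state :: "'d diagram \<Rightarrow> ('d set \<rightharpoonup> 'd set) \<Rightarrow> bool" where
  "perfect_state D x \<longleftrightarrow> dom x = crossings D"

definition admissible_state :: "'d diagram \<Rightarrow> ('d set \<rightharpoonup> 'd set) \<Rightarrow> bool" where
  "admissible_state D x \<longleftrightarrow> card (black D - ran x) = 1 \<and> card (white D - ran x) = 1"

definition state_subgraph ::
    "'d diagram \<Rightarrow> 'd set set \<Rightarrow> ('d set \<rightharpoonup> 'd set) \<Rightarrow> ('d set, 'd) pre_digraph" where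
  "state_subgraph D S x = (tait_graph D S)
     \<lparr> arcs := {d \<in> arcs (tait_graph D S). \<exists>r \<in> S. x (crossing D d) = Some r} \<rparr>"


context knot_diagram begin

lemma black_rot:
  assumes d: "d \<in> darts D"
  shows "region D (rot D d) \<in> black D \<longleftrightarrow> region D d \<notin> black D"
proof -
  let ?f = "inv (rot D) \<circ> opp D"
  have r: "rot D d \<in> darts D" using rot_permutes d by (simp add: permutes_in_image)
  hence o: "opp D (rot D d) \<in> darts D" using opp_permutes by (simp add: permutes_in_image)
  have f: "?f permutes darts D"
    using permutes_compose[OF opp_permutes permutes_inv[OF rot_permutes]] .
  have "?f (opp D (rot D d)) = d"
    by (simp add: opp_opp[OF r] permutes_inverses(2)[OF rot_permutes])
  moreover have "orbit ?f (?f (opp D (rot D d))) = orbit ?f (opp D (rot D d))"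
    using cyclic_on_orbit[OF f finite_darts] by (rule orbit_cyclic_eq3) (rule orbit.base)
  ultimately have "region D (opp D (rot D d)) = region D d" by (simp add: region_def)
  thus ?thesis using chequerboard[OF r] by simp
qed

text \<open>Opposite corners of a crossing have the same colour.\<close>

lemma wf_tait_graph:
  assumes "S \<in> {black D, white D}"
  shows "wf_digraph (tait_graph D S)"
proof
  fix e assume e: "e \<in> arcs (tait_graph D S)"
  hence d: "e \<in> darts D" and S: "region D e \<in> S" by (auto simp: tait_graph_def)
  have r: "rot D e \<in> darts D" using rot_permutes d by (simp add: permutes_in_image)
  hence rr: "rot D (rot D e) \<in> darts D" using rot_permutes by (simp add: permutes_in_image)
  show "tail (tait_graph D S) e \<in> verts (tait_graph D S)" using S by (simp add: tait_graph_def)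
  show "head (tait_graph D S) e \<in> verts (tait_graph D S)"
    using S assms rr black_rot[OF d] black_rot[OF r]
    by (auto simp: tait_graph_def opposite_corner_def white_def regions_def)
qed

lemma spanning_state_subgraph:
  assumes "S \<in> {black D, white D}"
  shows "spanning (state_subgraph D S x) (tait_graph D S)"
proof -
  interpret wf_digraph "tait_graph D S" by (rule wf_tait_graph[OF assms])
  have "wf_digraph (state_subgraph D S x)"
    by unfold_locales (use wellformed in \<open>auto simp: state_subgraph_def\<close>)
  thus ?thesis
    by (auto simp: spanning_def subgraph_def compatible_def state_subgraph_def wf_digraph)
qed

end


section \<open>Trees and geometric realization of bidirected multigraphs\<close>

text \<open>
  In a bidirected graph an edge that is not a loop forms a directed cycle with its reverse, so
  the predicate \<open>tree\<close> of the graph library is not the undirected one. An undirected cycle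
  is a directed one that does not use both directions of an edge.
\<close>

definition undirected_tree :: "('a \<Rightarrow> 'a) \<Rightarrow> ('v, 'a) pre_digraph \<Rightarrow> bool" where
  "undirected_tree rev_arc G \<longleftrightarrow> strongly_connected G \<and>
     \<not> (\<exists>p. pre_digraph.cycle G p \<and> (\<forall>a \<in> set p. rev_arc a \<notin> set p))"

text \<open>
  Subdividing every undirected edge \<open>{a, rev_arc a}\<close> by two new vertices \<open>Inr a\<close> and
  \<open>Inr (rev_arc a)\<close> makes a multigraph (possibly with loops and parallel edges) into a
  simplicial complex, which is then realized by barycentric coordinates. For finite graphs
  the product topology induces the usual topology on the realization.
\<close>

definition subdivision_simplices :: "('a \<Rightarrow> 'a) \<Rightarrow> ('v, 'a) pre_digraph \<Rightarrow> ('v + 'a) set set" where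
  "subdivision_simplices rev_arc G =
     (\<lambda>v. {Inl v}) ` verts G \<union>
     (\<lambda>a. {Inl (tail G a), Inr a}) ` arcs G \<union>
     (\<lambda>a. {Inr a, Inr (rev_arc a)}) ` arcs G"

definition geometric_realization :: "('a \<Rightarrow> 'a) \<Rightarrow> ('v, 'a) pre_digraph \<Rightarrow> ('v + 'a \<Rightarrow> real) topology" where
  "geometric_realization rev_arc G = top_of_set
     {f. (\<forall>i. 0 \<le> f i) \<and>
         (\<exists>s \<in> subdivision_simplices rev_arc G. {i. f i \<noteq> 0} \<subseteq> s \<and> (\<Sum>i\<in>s. f i) = 1)}"

definition has_homotopy_type_of_circle :: "('a \<Rightarrow> 'a) \<Rightarrow> ('v, 'a) pre_digraph \<Rightarrow> bool" where
  "has_homotopy_type_of_circle rev_arc G \<longleftrightarrow>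
     geometric_realization rev_arc G homotopy_equivalent_space top_of_set (sphere (0::complex) 1)"

end

(*
  Orient every edge of H_x away from the region matched with its crossing. As x is a matching, each
  region other than the unmatched one has exactly one outgoing edge, and the unmatched region r of
  that colour has none; so H_x is the graph of a function v -> succ v on the regions, cut at r.
  In the component of r all orbits end at r, and an undirected cycle is impossible at its vertex
  farthest from r. Any other component contains a unique periodic orbit, hence a cycle, and the
  flow along succ deforms its realization into that cycle.
*)
theory Submission
  imports Defs
begin

section \<open>Realizations of functional graphs\<close>

text \<open>The obstacle is to make the flow a continuous map on a space given by barycentric
  coordinates. The realization is a finite union of compact segments, one from each vertex
  \<open>w\<close> to \<open>g w\<close>, and every map out of it is given on each segment by a
  formula in the parameter. If segments meet only in end points, such formulas are compatible as
  soon as the value at the end of the segment of \<open>w\<close> is the value at the start of the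
  segment of \<open>g w\<close>. This breaks down for periods one and two, where a segment
  degenerates or is run through in both directions. The subdivision used to define the realization
  triples all periods and so removes the problem.

  Reducedness enters through the corners of a crossing: a region occupies at most one of them. Hence
  a matched region singles out one arc of the edge, and the reverse arc starts at a different
  region.\<close>

lemma Hausdorff_space_fun: "Hausdorff_space (euclidean :: ('a \<Rightarrow> 'b::metric_space) topology)"
  unfolding euclidean_product_topology[symmetric] by (simp add: Hausdorff_space_product_topology)

lemma Hausdorff_compact_imp_closed:
  "\<lbrakk>Hausdorff_space (euclidean :: 'a::topological_space topology); compact (K :: 'a set)\<rbrakk> \<Longrightarrow> closed K"
  using compactin_imp_closedin by force

text \<open>The preimage of a closed set under \<open>f\<close> is the \<open>q\<close>-image of a
  closed subset of \<open>A\<close>. That subset is compact, so its image is compact, hence closed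
  in a Hausdorff space.\<close>

lemma continuous_on_compact_quotient:
  fixes q :: "'a::topological_space \<Rightarrow> 'b::topological_space" and f :: "'b \<Rightarrow> 'c::topological_space"
  assumes T2: "Hausdorff_space (euclidean :: 'b topology)"
    and "compact A" and q: "continuous_on A q" and h: "continuous_on A (\<lambda>a. f (q a))"
  shows "continuous_on (q ` A) f"
  unfolding continuous_on_closed_vimage[OF Hausdorff_compact_imp_closed[OF T2
      compact_continuous_image[OF q \<open>compact A\<close>]]]
proof (intro allI impI)
  fix B :: "'c set" assume "closed B"
  then obtain K where K: "closed K" "K \<inter> A = (\<lambda>a. f (q a)) -` B \<inter> A"
    using h unfolding continuous_on_closed_invariant by blast
  have "f -` B \<inter> q ` A = q ` (K \<inter> A)"
    unfolding K by auto
  moreover have "compact (q ` (K \<inter> A))"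
    using K(1) \<open>compact A\<close> q
    by (intro compact_continuous_image closed_Int_compact) (auto intro: continuous_on_subset)
  ultimately show "closed (f -` B \<inter> q ` A)"
    by (simp add: Hausdorff_compact_imp_closed[OF T2])
qed

text \<open>By \<open>respects\<close>, the value at a point does not depend on the piece or the
  parameter that represents it. The map is continuous on each piece, being a map on a compact
  quotient, and finitely many closed pieces cover the union. Hausdorffness is a hypothesis on
  \<open>euclidean\<close> so that the lemma serves realizations, the circle and products with an
  interval alike.\<close>

lemma continuous_on_glued:
  fixes q :: "'i \<Rightarrow> 'a::topological_space \<Rightarrow> 'b::topological_space"
    and h :: "'i \<Rightarrow> 'a \<Rightarrow> 'c::topological_space"
  assumes T2: "Hausdorff_space (euclidean :: 'b topology)" and "finite I" and "compact A"
    and q: "\<And>i. i \<in> I \<Longrightarrow> continuous_on A (q i)"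
    and h: "\<And>i. i \<in> I \<Longrightarrow> continuous_on A (h i)"
    and respects: "\<And>i j a b. \<lbrakk>i \<in> I; j \<in> I; a \<in> A; b \<in> A; q i a = q j b\<rbrakk> \<Longrightarrow> h i a = h j b"
  obtains f where "continuous_on (\<Union>i\<in>I. q i ` A) f"
    and "\<And>i a. \<lbrakk>i \<in> I; a \<in> A\<rbrakk> \<Longrightarrow> f (q i a) = h i a"
proof -
  define f where "f y = (THE z. \<exists>i\<in>I. \<exists>a\<in>A. y = q i a \<and> z = h i a)" for y
  have f: "f (q i a) = h i a" if "i \<in> I" "a \<in> A" for i a
    unfolding f_def
  proof (rule the_equality)
    show "\<exists>j\<in>I. \<exists>b\<in>A. q i a = q j b \<and> h i a = h j b"
      using that by auto
    show "z = h i a" if "\<exists>j\<in>I. \<exists>b\<in>A. q i a = q j b \<and> z = h j b" for z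
      using that respects[OF \<open>i \<in> I\<close> _ \<open>a \<in> A\<close>] by metis
  qed
  have "continuous_on (q i ` A) f" if "i \<in> I" for i
    using h[OF that] f[OF that]
    by (intro continuous_on_compact_quotient T2 \<open>compact A\<close> q that) (auto cong: continuous_on_cong)
  then have "continuous_on (\<Union>i\<in>I. q i ` A) f"
    by (intro continuous_on_closed_Union \<open>finite I\<close>)
      (auto intro!: Hausdorff_compact_imp_closed[OF T2] compact_continuous_image q \<open>compact A\<close>)
  then show thesis using f by (rule that)
qed

section \<open>Segments and walks in barycentric coordinates\<close>

definition edge_point :: "('v \<Rightarrow> 'v) \<Rightarrow> 'v \<Rightarrow> real \<Rightarrow> 'v \<Rightarrow> real" where
  "edge_point g w t = (\<lambda>u. (1 - t) * of_bool (u = w) + t * of_bool (u = g w))"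

text \<open>
  The walk from \<open>w\<close> through \<open>g w\<close>, \<open>g (g w)\<close>, ... at unit speed, valid up to time \<open>M\<close>. Writing it
  with hat functions makes it continuous by inspection.
\<close>

definition orbit_path :: "nat \<Rightarrow> ('v \<Rightarrow> 'v) \<Rightarrow> 'v \<Rightarrow> real \<Rightarrow> 'v \<Rightarrow> real" where
  "orbit_path M g w \<tau> = (\<lambda>u. \<Sum>k\<le>M. max 0 (1 - \<bar>\<tau> - real k\<bar>) * of_bool (u = (g ^^ k) w))"

lemma continuous_on_edge_point: "continuous_on A (edge_point g w)"
  unfolding edge_point_def by (intro continuous_on_coordinatewise_then_product continuous_intros)

lemma continuous_on_orbit_path:
  assumes "continuous_on A f"
  shows "continuous_on A (\<lambda>a. orbit_path M g w (f a))"
  unfolding orbit_path_def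
  by (intro continuous_on_coordinatewise_then_product continuous_intros assms)

text \<open>Between times \<open>j\<close> and \<open>j + 1\<close> only the hats centred at these
  two times are nonzero, with values \<open>1 - t\<close> and \<open>t\<close>.\<close>

lemma orbit_path_eq_edge_point:
  assumes "j < M" "0 \<le> t" "t \<le> 1"
  shows "orbit_path M g w (real j + t) = edge_point g ((g ^^ j) w) t"
proof
  fix u
  have "orbit_path M g w (real j + t) u
      = (\<Sum>k\<in>{j, Suc j}. max 0 (1 - \<bar>real j + t - real k\<bar>) * of_bool (u = (g ^^ k) w))"
    unfolding orbit_path_def
  proof (intro sum.mono_neutral_right ballI)
    fix k assume "k \<in> {..M} - {j, Suc j}"
    then have "k < j \<or> Suc (Suc j) \<le> k" by auto
    then have "real k \<le> real j - 1 \<or> real j + 2 \<le> real k" by linarith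
    then show "max 0 (1 - \<bar>real j + t - real k\<bar>) * of_bool (u = (g ^^ k) w) = 0"
      using assms by (auto simp: max_def)
  qed (use assms in auto)
  then show "orbit_path M g w (real j + t) u = edge_point g ((g ^^ j) w) t u"
    using assms by (simp add: edge_point_def)
qed

lemma nat_add_unit_interval:
  assumes "0 \<le> \<tau>" "\<tau> \<le> real n"  "0 < n"
  obtains j t where "j < n" "0 \<le> t" "t \<le> 1" "\<tau> = real j + t"
proof (cases "\<tau> = real n")
  case True
  \<comment> \<open>At the right end the last unit interval is used with \<open>t = 1\<close>, which
    keeps \<open>j < n\<close> on the closed range.\<close>
  then show thesis using assms that[of "n - 1" 1] by auto
next
  case False
  then have "nat \<lfloor>\<tau>\<rfloor> < n" "0 \<le> \<lfloor>\<tau>\<rfloor>" using assms by (auto simp: nat_less_iff floor_less_iff)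
  then show thesis using that[of "nat \<lfloor>\<tau>\<rfloor>" "\<tau> - real (nat \<lfloor>\<tau>\<rfloor>)"]
    by (smt (verit) of_int_floor_le of_nat_nat real_of_int_floor_add_one_ge)
qed

text \<open>The semigroup law of the flow at integer times. Both sides run through the same segment
  on each unit interval, since the range stays below the cut-off \<open>M\<close>.\<close>

lemma orbit_path_shift:
  assumes "0 \<le> \<tau>" "\<tau> + real m \<le> real M" "0 < M - m"
  shows "orbit_path M g w (real m + \<tau>) = orbit_path M g ((g ^^ m) w) \<tau>"
proof -
  obtain j t where j: "j < M - m" "0 \<le> t" "t \<le> 1" "\<tau> = real j + t"
    using assms nat_add_unit_interval[of \<tau> "M - m"] by auto
  have "orbit_path M g w (real (j + m) + t) = orbit_path M g ((g ^^ m) w) (real j + t)"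
    using j by (subst (1 2) orbit_path_eq_edge_point) (auto simp: funpow_add)
  then show ?thesis using j by (simp add: algebra_simps)
qed

text \<open>Comparing coordinates at \<open>v\<close>, \<open>w\<close> and \<open>g w\<close> shows
  that distinct segments share only end points. The condition \<open>g (g v) \<noteq> v\<close>
  excludes a segment traversed in both directions, where \<open>t\<close> and \<open>1 - t\<close>
  would give the same point.\<close>

lemma edge_point_eqD:
  assumes eq: "edge_point g v s = edge_point g w t"
    and s: "0 \<le> s" "s \<le> 1" and t: "0 \<le> t" "t \<le> 1"
    and loopfree: "g v \<noteq> v" "g w \<noteq> w" "g (g v) \<noteq> v"
  shows "(v = w \<and> s = t) \<or> (s = 1 \<and> t = 0 \<and> w = g v) \<or> (s = 0 \<and> t = 1 \<and> v = g w) \<or>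
    (s = 1 \<and> t = 1 \<and> g v = g w)"
proof -
  have *: "(1 - s) * of_bool (u = v) + s * of_bool (u = g v)
      = (1 - t) * of_bool (u = w) + t * of_bool (u = g w)" for u
    using eq unfolding edge_point_def by metis
  show ?thesis
  proof (cases "v = w")
    case True
    then show ?thesis using *[of v] loopfree(1)[symmetric] by simp
  next
    case vw: False
    have v: "1 - s = t * of_bool (v = g w)" and w: "s * of_bool (w = g v) = 1 - t"
      using *[of v] *[of w] vw loopfree(1)[symmetric] loopfree(2)[symmetric] by simp_all
    have gw: "s * of_bool (g w = g v) = t" if "v \<noteq> g w"
      using *[of "g w"] that loopfree(2) by simp
    show ?thesis
    proof (cases "v = g w")
      case True
      then have "w \<noteq> g v" using loopfree(3) by metis
      then have "t = 1" using w by simp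
      then show ?thesis using v True by simp
    next
      case False
      have s1: "s = 1" using v False by simp
      have t: "t = of_bool (g w = g v)" using gw[OF False] s1 by simp
      show ?thesis
      proof (cases "g w = g v")
        case True
        then show ?thesis using s1 t by simp
      next
        case neq: False
        then have "of_bool (w = g v) = (1::real)" using w s1 t by simp
        then show ?thesis using neq s1 t by simp
      qed
    qed
  qed
qed

text \<open>Reduces well-definedness of a map given segment by segment to the matching condition
  \<open>h\<close> at the end points.\<close>

lemma edge_point_respects:
  assumes "edge_point g v s = edge_point g w t"
    and "0 \<le> s" "s \<le> 1" "0 \<le> t" "t \<le> 1"
    and "g v \<noteq> v" "g w \<noteq> w" "g (g v) \<noteq> v"
    and h: "h v 1 = h (g v) 0" "h w 1 = h (g w) 0"
  shows "h v s = h w t"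
  using edge_point_eqD[OF assms(1-8)] h by (elim disjE conjE) simp_all

section \<open>Periodic orbits and the parametrized circle\<close>

lemma minimal_periodE:
  assumes "0 < m" "(g ^^ m) w = w"
  obtains n where "0 < n" "(g ^^ n) w = w" "inj_on (\<lambda>k. (g ^^ k) w) {0..<n}"
proof -
  define n where "n = (LEAST n. 0 < n \<and> (g ^^ n) w = w)"
  have n: "0 < n \<and> (g ^^ n) w = w"
    unfolding n_def by (rule LeastI[of _ m]) (simp add: assms)
  moreover have "(g ^^ k) w \<noteq> w" if "0 < k" "k < n" for k
    using that not_less_Least[of k "\<lambda>n. 0 < n \<and> (g ^^ n) w = w"] by (simp add: n_def)
  ultimately show thesis
    by (intro that[of n] inj_on_funpow_least) auto
qed

lemma cis_periodic:
  assumes "a mod n = b mod n" "0 < n"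
  shows "cis (2 * pi * (real a + t) / real n) = cis (2 * pi * (real b + t) / real n)"
proof -
  have *: "cis (2 * pi * (real k + t) / real n) = cis (2 * pi * (real (k mod n) + t) / real n)" for k
  proof -
    have "real k = real n * real (k div n) + real (k mod n)"
      by (simp flip: of_nat_mult of_nat_add)
    then have "2 * pi * (real k + t) / real n
        = 2 * pi * (real (k mod n) + t) / real n + 2 * pi * real (k div n)"
      using \<open>0 < n\<close> by (simp add: field_simps)
    then show ?thesis
      by (simp add: cis_mult[symmetric])
  qed
  show ?thesis
    using *[of a] *[of b] assms(1) by simp
qed

text \<open>The angles differ by \<open>2 * pi * k\<close> with an integer \<open>k\<close>; since
  \<open>s\<close> and \<open>t\<close> are at most \<open>n\<close> apart, \<open>k\<close> is -1,
  0 or 1, and the values other than 0 force opposite ends of the interval.\<close>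

lemma cis_eq_on_period:
  assumes eq: "cis (2 * pi * s / real n) = cis (2 * pi * t / real n)" and "0 < n"
    and "0 \<le> s" "s \<le> real n" "0 \<le> t" "t \<le> real n"
  shows "s = t \<or> s = 0 \<and> t = real n \<or> s = real n \<and> t = 0"
proof -
  obtain k :: int where "2 * pi * s / real n = 2 * pi * t / real n + 2 * pi * of_int k"
    using eq sin_cos_eq_iff[of "2 * pi * s / real n" "2 * pi * t / real n"]
    by (auto simp: complex_eq_iff)
  then have "2 * pi * s = 2 * pi * (t + of_int k * real n)"
    using \<open>0 < n\<close> by (simp add: field_simps)
  then have k: "s = t + of_int k * real n"
    by simp
  have "k \<le> 1"
  proof (rule ccontr)
    assume "\<not> k \<le> 1"
    then have "2 * real n \<le> of_int k * real n"
      by (intro mult_right_mono) auto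
    then show False using k assms by linarith
  qed
  moreover have "-1 \<le> k"
  proof (rule ccontr)
    assume "\<not> -1 \<le> k"
    then have "of_int k * real n \<le> (- 2) * real n"
      by (intro mult_right_mono) auto
    then show False using k assms by linarith
  qed
  ultimately have "k = -1 \<or> k = 0 \<or> k = 1" by arith
  then show ?thesis using k assms by auto
qed

lemma image_cis_period:
  assumes "0 < n"
  shows "(\<lambda>t. cis (2 * pi * t / real n)) ` {0..real n} = sphere 0 1"
proof
  show "sphere 0 1 \<subseteq> (\<lambda>t. cis (2 * pi * t / real n)) ` {0..real n}"
  proof
    fix z :: complex assume "z \<in> sphere 0 1"
    then have z: "z = cis (Arg2pi z)"
      using Arg2pi_eq[of z] by (simp add: cis_conv_exp)
    let ?t = "real n * Arg2pi z / (2 * pi)"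
    have "cis (2 * pi * ?t / real n) = z" using \<open>0 < n\<close> z by simp
    moreover have "?t \<in> {0..real n}"
      using Arg2pi_ge_0[of z] Arg2pi_lt_2pi[of z] \<open>0 < n\<close>
      by (auto simp: field_simps intro!: mult_left_mono)
    ultimately show "z \<in> (\<lambda>t. cis (2 * pi * t / real n)) ` {0..real n}"
      by (metis (no_types, lifting) image_eqI)
  qed
qed auto

text \<open>
  Map the segment from \<open>w\<close> to \<open>g w\<close> to the circle by the position that \<open>w\<close> reaches on the cycle
  after a long time \<open>N\<close>, a multiple of the period \<open>n\<close>, and include the circle as the cycle. One
  composite is the identity; the other is the time \<open>N\<close> map of the flow along \<open>g\<close>, which is
  homotopic to the identity through the flow.
\<close>

lemma functional_graph_homotopy_circle:
  fixes g :: "'v \<Rightarrow> 'v"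
  assumes "finite W" and g: "\<And>w. w \<in> W \<Longrightarrow> g w \<in> W"
    and loopfree: "\<And>w. w \<in> W \<Longrightarrow> g w \<noteq> w" "\<And>w. w \<in> W \<Longrightarrow> g (g w) \<noteq> w"
    and w0: "w0 \<in> W" and reach: "\<And>w. w \<in> W \<Longrightarrow> \<exists>m. (g ^^ m) w = w0"
  shows "top_of_set (\<Union>w\<in>W. edge_point g w ` {0..1})
    homotopy_equivalent_space top_of_set (sphere (0::complex) 1)"
proof -
  let ?X = "\<Union>w\<in>W. edge_point g w ` {0..1}"
  have gk: "(g ^^ k) w \<in> W" if "w \<in> W" for w k
    using that by (induction k) (auto intro: g)
  \<comment> \<open>At \<open>w0\<close> itself \<open>reach\<close> could be met by zero steps;
    starting from \<open>g w0\<close> gives a positive period.\<close>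
  obtain m where "(g ^^ m) (g w0) = w0"
    using reach[OF g[OF w0]] by blast
  then have "(g ^^ Suc m) w0 = w0"
    by (simp add: funpow_swap1)
  then obtain n where n: "0 < n" "(g ^^ n) w0 = w0" and inj: "inj_on (\<lambda>k. (g ^^ k) w0) {0..<n}"
    by (rule minimal_periodE[rotated]) auto
  have orbit_mod: "(g ^^ (k mod n)) w0 = (g ^^ k) w0" for k
    by (rule funpow_mod_eq[OF n(2)])
  have orbit_inj: "a mod n = b mod n" if "(g ^^ a) w0 = (g ^^ b) w0" for a b
    using that inj_onD[OF inj, of "a mod n" "b mod n"] n(1) orbit_mod[of a] orbit_mod[of b] by simp

  obtain l where l: "\<And>w. w \<in> W \<Longrightarrow> (g ^^ l w) w = w0"
    using reach by metis
  \<comment> \<open>As \<open>n\<close> is positive, \<open>N\<close> is at least every arrival time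
    \<open>l w\<close>, so at time \<open>N\<close> every vertex is on the cycle. As
    \<open>N\<close> is a multiple of \<open>n\<close>, the vertices of the cycle are then back at
    their places.\<close>
  define N where "N = n * Max (l ` W)"
  \<comment> \<open>Walks are evaluated up to time \<open>n\<close> for the map from the circle and
    up to \<open>N + 1\<close> for the homotopy; \<open>M\<close> lies beyond both, with room for
    the strict bounds.\<close>
  define M where "M = N + n + 2"
  have lN: "l w \<le> N" if "w \<in> W" for w
  proof -
    have "l w \<le> Max (l ` W)" using that \<open>finite W\<close> by simp
    also have "\<dots> \<le> N" using n(1) by (simp add: N_def)
    finally show ?thesis .
  qed
  \<comment> \<open>From \<open>w\<close> the walk is at \<open>w0\<close> after \<open>l w\<close>
    steps, and the remaining \<open>N - l w\<close> steps go round the cycle. The reduction modulo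
    \<open>n\<close> keeps \<open>lam w + t\<close> within the parameter range of the
    circle.\<close>
  define lam where "lam w = (N - l w) mod n" for w
  have lam_less: "lam w < n" for w using n(1) by (simp add: lam_def)
  have lam: "(g ^^ N) w = (g ^^ lam w) w0" if "w \<in> W" for w
  proof -
    have "(g ^^ N) w = (g ^^ (N - l w + l w)) w" using lN[OF that] by simp
    also have "\<dots> = (g ^^ (N - l w)) w0" unfolding funpow_add by (simp add: l that)
    finally show ?thesis by (simp add: lam_def orbit_mod)
  qed
  have gN: "(g ^^ N) ((g ^^ k) w) = (g ^^ k) ((g ^^ N) w)" for k w
    by (simp add: funpow_add[symmetric, THEN fun_cong, unfolded comp_def] add.commute)
  have lam_step: "(lam w + 1) mod n = lam (g w) mod n" if "w \<in> W" for w
    using gN[of 1 w] lam[OF that] lam[OF g[OF that]] by (intro orbit_inj) simp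
  have lam_orbit: "lam ((g ^^ k) w0) mod n = k mod n" for k
  proof (rule orbit_inj)
    have "(g ^^ N) w0 = w0"
      using orbit_mod[of N] by (simp add: N_def)
    then show "(g ^^ lam ((g ^^ k) w0)) w0 = (g ^^ k) w0"
      using lam[OF gk[OF w0]] gN[of k w0] by simp
  qed

  let ?c = "\<lambda>t. cis (2 * pi * t / real n)"
  obtain F where F: "continuous_on ?X F"
    and F_eq: "\<And>w t. \<lbrakk>w \<in> W; t \<in> {0..1}\<rbrakk> \<Longrightarrow> F (edge_point g w t) = ?c (real (lam w) + t)"
  proof (rule continuous_on_glued[of W "{0..1}" "edge_point g" "\<lambda>w t. ?c (real (lam w) + t)"])
    fix v w and s t :: real
    assume vw: "v \<in> W" "w \<in> W" and st: "s \<in> {0..1}" "t \<in> {0..1}"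
      and eq: "edge_point g v s = edge_point g w t"
    have step: "?c (real (lam w) + 1) = ?c (real (lam (g w)) + 0)" if "w \<in> W" for w
      using cis_periodic[OF lam_step[OF that] n(1), of 0] by (simp add: add.commute)
    show "?c (real (lam v) + s) = ?c (real (lam w) + t)"
      using st loopfree vw
      by (intro edge_point_respects[OF eq, where h = "\<lambda>w t. ?c (real (lam w) + t)"] step) auto
  qed (use \<open>finite W\<close> n in \<open>auto intro!: continuous_intros continuous_on_edge_point Hausdorff_space_fun\<close>)

  have path0: "orbit_path M g w t = edge_point g w t" if "0 \<le> t" "t \<le> 1" for w t
    using orbit_path_eq_edge_point[of 0 M t g w] that by (simp add: M_def)
  \<comment> \<open>The circle is a quotient of one interval, hence the one-element index set; the
    walk is compatible with it because it closes up at time \<open>n\<close>.\<close>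
  obtain G where G: "continuous_on (sphere 0 1) G"
    and G_eq: "\<And>t. t \<in> {0..real n} \<Longrightarrow> G (?c t) = orbit_path M g w0 t"
  proof (rule continuous_on_glued[of "{()}" "{0..real n}" "\<lambda>_. ?c" "\<lambda>_. orbit_path M g w0"])
    fix s t :: real
    assume "s \<in> {0..real n}" "t \<in> {0..real n}" "?c s = ?c t"
    moreover have "orbit_path M g w0 (real n) = orbit_path M g w0 0"
      using orbit_path_eq_edge_point[of n M 0 g w0] path0[of 0 w0] n by (simp add: M_def)
    ultimately show "orbit_path M g w0 s = orbit_path M g w0 t"
      using cis_eq_on_period[of s n t] n(1) by auto
  next
    fix G assume "continuous_on (\<Union>i\<in>{()}. ?c ` {0..real n}) G"
      and "\<And>i t. \<lbrakk>i \<in> {()}; t \<in> {0..real n}\<rbrakk> \<Longrightarrow> G (?c t) = orbit_path M g w0 t"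
    then show thesis
      using that[of G] image_cis_period[OF n(1)] by simp
  qed (use n in \<open>auto intro!: continuous_intros continuous_on_orbit_path[where f = "\<lambda>t. t"]\<close>)

  \<comment> \<open>The homotopy parameter \<open>s\<close> is carried along in the glued pieces,
    which makes \<open>H\<close> jointly continuous. At \<open>s\<close> the flow has run for time
    \<open>s * N\<close>.\<close>
  obtain H where H: "continuous_on (\<Union>w\<in>W. (\<lambda>(s, t). (s, edge_point g w t)) ` ({0..1} \<times> {0..1})) H"
    and H_eq: "\<And>w st. \<lbrakk>w \<in> W; st \<in> {0..1} \<times> {0..1}\<rbrakk> \<Longrightarrow>
      H ((\<lambda>(s, t). (s, edge_point g w t)) st) = (\<lambda>(s, t). orbit_path M g w (t + s * real N)) st"
  proof (rule continuous_on_glued[of W "{0..1} \<times> {0..1}" "\<lambda>w (s, t). (s, edge_point g w t)"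
        "\<lambda>w (s, t). orbit_path M g w (t + s * real N)"])
    fix v w and a b :: "real \<times> real"
    assume vw: "v \<in> W" "w \<in> W" and ab: "a \<in> {0..1} \<times> {0..1}" "b \<in> {0..1} \<times> {0..1}"
      and "(\<lambda>(s, t). (s, edge_point g v t)) a = (\<lambda>(s, t). (s, edge_point g w t)) b"
    then obtain s t t' where a: "a = (s, t)" and b: "b = (s, t')"
      and eq: "edge_point g v t = edge_point g w t'"
      by (auto split: prod.splits)
    have "0 \<le> s" "s \<le> 1" using ab a by auto
    then have "s * real N + 1 \<le> real M"
      using mult_left_le_one_le[of "real N" s] by (simp add: M_def)
    then have step: "orbit_path M g w (1 + s * real N) = orbit_path M g (g w) (0 + s * real N)" for w
      using orbit_path_shift[of "s * real N" 1 M g w] \<open>0 \<le> s\<close> by (simp add: M_def)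
    have "orbit_path M g v (t + s * real N) = orbit_path M g w (t' + s * real N)"
      using ab loopfree vw unfolding a b
      by (intro edge_point_respects[OF eq, where h = "\<lambda>w t. orbit_path M g w (t + s * real N)"]
          step) auto
    then show "(\<lambda>(s, t). orbit_path M g v (t + s * real N)) a
        = (\<lambda>(s, t). orbit_path M g w (t + s * real N)) b"
      by (simp add: a b)
  next
    show "Hausdorff_space (euclidean :: (real \<times> ('v \<Rightarrow> real)) topology)"
      by (simp add: Hausdorff_space_fun Hausdorff_space_euclidean Hausdorff_space_prod_topology
          flip: prod_topology_euclidean)
    show "compact ({0..1} \<times> {0..1} :: (real \<times> real) set)"
      by (intro compact_Times) auto
    show "continuous_on ({0..1} \<times> {0..1}) (\<lambda>(s, t). (s, edge_point g w t))" for w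
      unfolding case_prod_beta
      by (intro continuous_on_Pair continuous_intros
          continuous_on_compose2[OF continuous_on_edge_point[of UNIV]]) auto
    show "continuous_on ({0..1} \<times> {0..1}) (\<lambda>(s, t). orbit_path M g w (t + s * real N))" for w
      unfolding case_prod_beta
      by (intro continuous_on_orbit_path continuous_intros)
  qed (use \<open>finite W\<close> in auto)
  have H_eq': "H (s, edge_point g w t) = orbit_path M g w (t + s * real N)"
    if "w \<in> W" "s \<in> {0..1}" "t \<in> {0..1}" for w s t
    using H_eq[of w "(s, t)"] that by simp
  have "(\<Union>w\<in>W. (\<lambda>(s, t). (s, edge_point g w t)) ` ({0..1::real} \<times> {0..1})) = {0..1} \<times> ?X"
    by auto
  with H have H: "continuous_on ({0..1} \<times> ?X) H" by simp

  have path_in: "orbit_path M g w t \<in> ?X" if "w \<in> W" "0 \<le> t" "t \<le> real (M - 1)" for w t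
  proof -
    obtain j r where "j < M - 1" "0 \<le> r" "r \<le> 1" "t = real j + r"
      using nat_add_unit_interval[of t "M - 1"] \<open>0 \<le> t\<close> \<open>t \<le> real (M - 1)\<close> by (auto simp: M_def)
    then have "orbit_path M g w t = edge_point g ((g ^^ j) w) r"
      using orbit_path_eq_edge_point[of j M r g w] by simp
    then show ?thesis
      using gk[OF \<open>w \<in> W\<close>, of j] \<open>0 \<le> r\<close> \<open>r \<le> 1\<close>
      by (intro UN_I[of "(g ^^ j) w"]) auto
  qed
  have FX: "F ` ?X \<subseteq> sphere 0 1"
    using F_eq by auto
  have GS: "G ` sphere 0 1 \<subseteq> ?X"
    unfolding image_cis_period[OF n(1), symmetric]
    using G_eq path_in[OF w0] by (auto simp: M_def simp del: UN_iff)
  have HX: "H ` ({0..1} \<times> ?X) \<subseteq> ?X"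
  proof (intro image_subsetI)
    fix a :: "real \<times> _" assume "a \<in> {0..1} \<times> ?X"
    then obtain s w t where a: "a = (s, edge_point g w t)" "s \<in> {0..1}" "w \<in> W" "t \<in> {0..1}"
      by blast
    have "s * real N \<le> real N" using a mult_left_le_one_le[of "real N" s] by simp
    then have "t + s * real N \<le> real (M - 1)" using a by (simp add: M_def)
    then show "H a \<in> ?X"
      using H_eq'[of w s t] a path_in[of w "t + s * real N"] by simp
  qed
  have FG: "F (G z) = z" if "z \<in> sphere 0 1" for z
  proof -
    obtain \<tau> where "\<tau> \<in> {0..real n}" "z = ?c \<tau>"
      using \<open>z \<in> sphere 0 1\<close> unfolding image_cis_period[OF n(1), symmetric] by blast
    moreover obtain j t where j: "j < n" "0 \<le> t" "t \<le> 1" "\<tau> = real j + t"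
      using nat_add_unit_interval[of \<tau> n] \<open>\<tau> \<in> {0..real n}\<close> n(1) by auto
    ultimately have "G z = edge_point g ((g ^^ j) w0) t"
      using orbit_path_eq_edge_point[of j M t g w0] G_eq[of \<tau>] by (simp add: M_def)
    then have "F (G z) = ?c (real (lam ((g ^^ j) w0)) + t)"
      using F_eq[OF gk[OF w0]] j by simp
    also have "\<dots> = ?c (real j + t)"
      by (rule cis_periodic[OF lam_orbit n(1)])
    finally show ?thesis using \<open>z = ?c \<tau>\<close> j by simp
  qed
  have GF: "G (F f) = H (1, f)" if "f \<in> ?X" for f
  proof -
    obtain w t where wt: "w \<in> W" "t \<in> {0..1}" "f = edge_point g w t"
      using \<open>f \<in> ?X\<close> by blast
    have "real (lam w) + t \<le> real n" using lam_less[of w] wt by simp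
    then have "G (F f) = orbit_path M g w0 (real (lam w) + t)"
      using F_eq G_eq[of "real (lam w) + t"] wt by simp
    also have "\<dots> = edge_point g ((g ^^ N) w) t"
      using orbit_path_eq_edge_point[of "lam w" M t g w0] lam_less[of w] wt by (simp add: M_def lam)
    also have "\<dots> = orbit_path M g w (t + 1 * real N)"
      using orbit_path_eq_edge_point[of N M t g w] wt by (simp add: M_def add.commute)
    also have "\<dots> = H (1, f)"
      using H_eq'[of w 1 t] wt by simp
    finally show ?thesis .
  qed
  have H0: "H (0, f) = f" if "f \<in> ?X" for f
    using that H_eq'[of _ 0] path0 by auto

  have "homotopic_with (\<lambda>x. True) (top_of_set ?X) (top_of_set ?X) id (G \<circ> F)"
  proof (subst homotopic_with)
    show "\<exists>h. continuous_map (prod_topology (top_of_set {0..1::real}) (top_of_set ?X)) (top_of_set ?X) h \<and>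
      (\<forall>x\<in>topspace (top_of_set ?X). h (0, x) = id x) \<and>
      (\<forall>x\<in>topspace (top_of_set ?X). h (1, x) = (G \<circ> F) x) \<and> (\<forall>t\<in>{0..1}. True)"
      using H HX H0 GF
      by (intro exI[of _ H])
        (simp add: prod_topology_subtopology_eu image_subset_iff_funcset del: UN_iff)
  qed simp
  moreover have "homotopic_with (\<lambda>x. True) (top_of_set (sphere 0 1)) (top_of_set (sphere 0 1)) (F \<circ> G) id"
  proof (rule homotopic_with_equal)
    show "continuous_map (top_of_set (sphere 0 1)) (top_of_set (sphere 0 1)) (F \<circ> G)"
      using F G FX GS
      by (intro continuous_map_compose[of _ "top_of_set ?X"])
        (simp_all add: image_subset_iff_funcset del: UN_iff)
  qed (use FG in auto)
  ultimately show ?thesis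
    unfolding homotopy_equivalent_space_def
    using F G FX GS
    by (intro exI[of _ F] exI[of _ G])
      (simp add: homotopic_with_sym image_subset_iff_funcset del: UN_iff)
qed

text \<open>A point supported in \<open>{w, g w}\<close> with total weight 1 is determined by its
  weight \<open>t\<close> at \<open>g w\<close>; a simplex \<open>{w}\<close> contributes the start
  of the segment, \<open>t = 0\<close>.\<close>

lemma functional_complex_realization:
  fixes g :: "'v \<Rightarrow> 'v"
  assumes S: "\<And>s. s \<in> S \<Longrightarrow> \<exists>w\<in>W. s = {w} \<or> s = {w, g w}"
    and edge: "\<And>w. w \<in> W \<Longrightarrow> {w, g w} \<in> S" and loopfree: "\<And>w. w \<in> W \<Longrightarrow> g w \<noteq> w"
  shows "{f. (\<forall>i. 0 \<le> f i) \<and> (\<exists>s\<in>S. {i. f i \<noteq> 0} \<subseteq> s \<and> sum f s = 1)}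
    = (\<Union>w\<in>W. edge_point g w ` {0..1})"
proof (intro subset_antisym subsetI)
  fix f :: "'v \<Rightarrow> real" assume "f \<in> {f. (\<forall>i. 0 \<le> f i) \<and> (\<exists>s\<in>S. {i. f i \<noteq> 0} \<subseteq> s \<and> sum f s = 1)}"
  then obtain s where f: "\<And>i. 0 \<le> f i" and "s \<in> S" and supp: "{i. f i \<noteq> 0} \<subseteq> s" and sum: "sum f s = 1"
    by auto
  obtain w where w: "w \<in> W" "s = {w} \<or> s = {w, g w}"
    using S[OF \<open>s \<in> S\<close>] by auto
  have out: "f u = 0" if "u \<noteq> w" "u \<noteq> g w" for u
    using supp w(2) that by auto
  have total: "f w + f (g w) = 1"
    using w(2)
  proof
    assume "s = {w}"
    then have "f (g w) = 0" using supp loopfree[OF w(1)] by blast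
    then show ?thesis using sum \<open>s = {w}\<close> by simp
  qed (use sum loopfree[OF w(1), symmetric] in simp)
  obtain t where t: "f (g w) = t" "f w = 1 - t"
    using total by (simp add: eq_diff_eq)
  have "f u = edge_point g w t u" for u
    using t out[of u] loopfree[OF w(1)] by (cases "u = w"; cases "u = g w") (auto simp: edge_point_def)
  then have "f = edge_point g w t" by (rule ext)
  moreover have "t \<in> {0..1}" using f[of w] f[of "g w"] t by simp
  ultimately show "f \<in> (\<Union>w\<in>W. edge_point g w ` {0..1})" using w(1) by blast
next
  fix f :: "'v \<Rightarrow> real" assume "f \<in> (\<Union>w\<in>W. edge_point g w ` {0..1})"
  then obtain w t where w: "w \<in> W" and t: "0 \<le> t" "t \<le> 1" and f: "f = edge_point g w t" by auto
  have "{i. f i \<noteq> 0} \<subseteq> {w, g w}" "sum f {w, g w} = 1" "\<forall>i. 0 \<le> f i"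
    using t loopfree[OF w] by (auto simp: f edge_point_def)
  then show "f \<in> {f. (\<forall>i. 0 \<le> f i) \<and> (\<exists>s\<in>S. {i. f i \<noteq> 0} \<subseteq> s \<and> sum f s = 1)}"
    using edge[OF w] by blast
qed

section \<open>Bidirected graphs with at most one outgoing arc at each vertex\<close>

text \<open>Both sides are the set of vertices visited. For a nonempty closed walk the inserted end
  points are absorbed, so every vertex that is entered is also left.\<close>

lemma (in pre_digraph) cas_tails_heads:
  "cas u p v \<Longrightarrow> insert v (tail G ` set p) = insert u (head G ` set p)"
  by (induction u p v rule: cas.induct) auto

lemma (in pre_digraph) cas_ends:
  assumes "cas u p v" "p \<noteq> []"
  shows "u \<in> tail G ` set p" "v \<in> head G ` set p"
  using assms by (induction u p v rule: cas.induct) (auto, metis cas.simps(1))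

text \<open>In the application \<open>F\<close> consists of the arcs that leave the region matched
  with their crossing, and \<open>r\<close> is the unmatched region. By \<open>orientation\<close>,
  \<open>F\<close> contains exactly one of each arc and its reverse; in particular no arc is its own
  reverse.\<close>

locale oriented_functional_graph = fin_digraph +
  fixes rev_arc :: "'b \<Rightarrow> 'b" and F :: "'b set" and r :: 'a
  assumes rev_arc_in: "a \<in> arcs G \<Longrightarrow> rev_arc a \<in> arcs G"
    and rev_rev: "a \<in> arcs G \<Longrightarrow> rev_arc (rev_arc a) = a"
    and tail_rev: "a \<in> arcs G \<Longrightarrow> tail G (rev_arc a) = head G a"
    and F_subset: "F \<subseteq> arcs G"
    and orientation: "a \<in> arcs G \<Longrightarrow> rev_arc a \<in> F \<longleftrightarrow> a \<notin> F"
    and inj_tail: "inj_on (tail G) F"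
    and tail_F: "tail G ` F = verts G - {r}"
    and root: "r \<in> verts G"
begin

definition out :: "'a \<Rightarrow> 'b" where
  "out v = inv_into F (tail G) v"

text \<open>The value at \<open>r\<close> is a convention that makes \<open>r\<close> absorbing, so
  that meeting the orbit of \<open>r\<close> means reaching \<open>r\<close>.\<close>

definition succ :: "'a \<Rightarrow> 'a" where
  "succ v = (if v = r then r else head G (out v))"

lemma head_rev: "a \<in> arcs G \<Longrightarrow> head G (rev_arc a) = tail G a"
  using tail_rev[OF rev_arc_in, of a] rev_rev[of a] by simp

lemma out_in_F: "\<lbrakk>v \<in> verts G; v \<noteq> r\<rbrakk> \<Longrightarrow> out v \<in> F"
  and tail_out: "\<lbrakk>v \<in> verts G; v \<noteq> r\<rbrakk> \<Longrightarrow> tail G (out v) = v"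
  unfolding out_def using tail_F by (auto intro: inv_into_into f_inv_into_f)

lemma tail_neq_root: "a \<in> F \<Longrightarrow> tail G a \<noteq> r"
  using tail_F by auto

lemma out_tail: "a \<in> F \<Longrightarrow> out (tail G a) = a"
  unfolding out_def by (rule inv_into_f_f[OF inj_tail])

lemma succ_tail: "a \<in> F \<Longrightarrow> succ (tail G a) = head G a"
  by (simp add: succ_def tail_neq_root out_tail)

text \<open>Every arc is a step of \<open>succ\<close> in one of its two directions. Appending it to
  a path therefore costs one more step on the orbit of \<open>u\<close> or on that of the new end
  point.\<close>

lemma reachable_imp_orbits_meet:
  assumes "u \<rightarrow>\<^sup>*\<^bsub>G\<^esub> v"
  shows "\<exists>j k. (succ ^^ j) u = (succ ^^ k) v"
  using assms
proof (induction rule: reachable_induct)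
  case base
  then show ?case by blast
next
  case (step x y)
  then obtain j k where jk: "(succ ^^ j) u = (succ ^^ k) x" by blast
  obtain a where a: "a \<in> arcs G" "tail G a = x" "head G a = y"
    using step(2) by auto
  show ?case
  proof (cases "a \<in> F")
    case True
    then have "succ x = y" using succ_tail a by blast
    then have "(succ ^^ Suc j) u = (succ ^^ k) y"
      using jk by (simp add: funpow_swap1)
    then show ?thesis by blast
  next
    case False
    then have "succ y = x"
      using succ_tail[of "rev_arc a"] orientation tail_rev head_rev a by auto
    then have "(succ ^^ j) u = (succ ^^ Suc k) y"
      using jk by (simp add: funpow_swap1)
    then show ?thesis by blast
  qed
qed

section \<open>Strong components as connected components of the undirected graph\<close>

lemma scc_tail_head:
  assumes "C \<in> sccs"
  shows "tail C = tail G" "head C = head G"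
  using in_sccs_imp_induced[OF assms] by (auto simp: induced_subgraph_def subgraph_def compatible_def)

lemma scc_verts_subset: "C \<in> sccs \<Longrightarrow> verts C \<subseteq> verts G"
  by (auto dest!: in_sccs_imp_induced simp: induced_subgraph_def subgraph_def)

lemma scc_nonempty: "C \<in> sccs \<Longrightarrow> verts C \<noteq> {}"
  by (auto simp: sccs_def strongly_connected_def)

lemma scc_reachable:
  assumes "C \<in> sccs" "u \<in> verts C" "v \<in> verts C"
  shows "u \<rightarrow>\<^sup>*\<^bsub>G\<^esub> v"
  using in_sccs_vertsI_sccs[of "verts C"] assms by (auto simp: sccs_verts_def)

text \<open>The reverse arc leads back, so head and tail are mutually reachable. Hence no arc leaves
  a strong component, and strong components are the connected components.\<close>

lemma scc_closed:
  assumes C: "C \<in> sccs" and a: "a \<in> arcs G" and t: "tail G a \<in> verts C"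
  shows "head G a \<in> verts C"
proof (rule ccontr)
  assume "head G a \<notin> verts C"
  moreover have "tail G a \<rightarrow>\<^sup>*\<^bsub>G\<^esub> head G a" using a by (auto intro: reachable_adjI simp: arcs_ends_def arc_to_ends_def)
  moreover have "head G a \<rightarrow>\<^sup>*\<^bsub>G\<^esub> tail G a"
  proof (rule reachable_adjI)
    show "head G a \<rightarrow>\<^bsub>G\<^esub> tail G a"
      unfolding arcs_ends_def arc_to_ends_def
      using rev_arc_in[OF a] tail_rev[OF a] head_rev[OF a] by (intro image_eqI[of _ _ "rev_arc a"]) auto
  qed
  ultimately show False
    using in_sccs_vertsI_sccs[of "verts C"] C t by (auto simp: sccs_verts_def)
qed

lemma scc_arcs: "C \<in> sccs \<Longrightarrow> arcs C = {a \<in> arcs G. tail G a \<in> verts C}"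
  using scc_closed[of C] in_sccs_imp_induced[of C] by (auto simp: induced_subgraph_def)

lemma scc_rev:
  assumes "C \<in> sccs" "a \<in> arcs C"
  shows "rev_arc a \<in> arcs C"
  using assms scc_closed[OF assms(1)] by (auto simp: scc_arcs rev_arc_in tail_rev)

lemma scc_succ:
  assumes C: "C \<in> sccs" and v: "v \<in> verts C"
  shows "succ v \<in> verts C"
proof (cases "v = r")
  case False
  have "v \<in> verts G" using scc_verts_subset[OF C] v by blast
  then have "out v \<in> arcs G" "tail G (out v) = v"
    using F_subset out_in_F tail_out False by auto
  then show ?thesis using scc_closed[OF C, of "out v"] v False by (simp add: succ_def)
qed (use v in \<open>simp add: succ_def\<close>)

lemma scc_succ_funpow: "\<lbrakk>C \<in> sccs; v \<in> verts C\<rbrakk> \<Longrightarrow> (succ ^^ k) v \<in> verts C"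
  by (induction k) (auto intro: scc_succ)

text \<open>
  An undirected cycle leaves and enters its vertex farthest from the root through the same edge,
  namely the one towards the root.
\<close>

lemma root_component_tree:
  assumes C: "C \<in> sccs" and r: "r \<in> verts C"
  shows "undirected_tree rev_arc C"
  unfolding undirected_tree_def
proof (intro conjI notI)
  show "strongly_connected C" using C by (simp add: sccs_def)
next
  assume "\<exists>p. pre_digraph.cycle C p \<and> (\<forall>a\<in>set p. rev_arc a \<notin> set p)"
  then obtain u p where p: "pre_digraph.awalk C u p u" "p \<noteq> []" and norev: "\<And>a. a \<in> set p \<Longrightarrow> rev_arc a \<notin> set p"
    by (auto simp: pre_digraph.cycle_def)
  then have arcs: "set p \<subseteq> arcs C" and cas: "pre_digraph.cas C u p u"
    by (auto simp: pre_digraph.awalk_def)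
  have ends: "tail G ` set p = head G ` set p"
    using pre_digraph.cas_tails_heads[OF cas] pre_digraph.cas_ends[OF cas p(2)]
    by (simp add: scc_tail_head[OF C] insert_absorb)
  define depth where "depth v = (LEAST k. (succ ^^ k) v = r)" for v
  have depth: "depth (tail G a) = Suc (depth (head G a))" if "a \<in> arcs C" "a \<in> F" for a
  proof -
    have "tail G a \<in> verts C" using that C by (simp add: scc_arcs)
    then obtain j k where "(succ ^^ j) (tail G a) = (succ ^^ k) r"
      using reachable_imp_orbits_meet[OF scc_reachable[OF C _ r]] by blast
    moreover have "(succ ^^ k) r = r"
      by (induction k) (auto simp: succ_def)
    ultimately have "(succ ^^ j) (tail G a) = r" by simp
    then have "depth (tail G a) = Suc (LEAST k. (succ ^^ Suc k) (tail G a) = r)"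
      unfolding depth_def using tail_neq_root[OF that(2)] by (intro Least_Suc) auto
    then show ?thesis
      by (simp add: depth_def funpow_swap1 succ_tail[OF that(2)])
  qed
  let ?d = "\<lambda>a. depth (tail G a)"
  obtain a where a: "a \<in> set p" and max: "\<And>b. b \<in> set p \<Longrightarrow> ?d b \<le> ?d a"
  proof -
    have "Max (?d ` set p) \<in> ?d ` set p" using p(2) by (intro Max_in) auto
    then obtain a where "Max (?d ` set p) = ?d a" "a \<in> set p" by (rule imageE)
    then show thesis using that[of a] Max_ge[of "?d ` set p"] by simp
  qed
  \<comment> \<open>The arc \<open>b\<close> enters the deepest vertex \<open>tail G a\<close>;
    \<open>c\<close> shows that \<open>head G a\<close> is again a tail on the walk, so that
    \<open>max\<close> bounds its depth too.\<close>
  have "tail G a \<in> head G ` set p" "head G a \<in> tail G ` set p"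
    using a ends by blast+
  then obtain b c where b: "b \<in> set p" "head G b = tail G a" and c: "c \<in> set p" "tail G c = head G a"
    by (elim imageE) simp
  have aC: "a \<in> arcs C" and bC: "b \<in> arcs C" using a b arcs by auto
  then have aG: "a \<in> arcs G" and bG: "b \<in> arcs G" using C by (auto simp: scc_arcs)
  have "a \<in> F"
  proof (rule ccontr)
    assume "a \<notin> F"
    then have "depth (head G a) = Suc (depth (tail G a))"
      using depth[OF scc_rev[OF C aC]] aG by (simp add: orientation tail_rev head_rev)
    then show False using max[OF c(1)] c(2) by simp
  qed
  moreover have "rev_arc b \<in> F"
  proof (rule ccontr)
    assume "rev_arc b \<notin> F"
    then have "depth (tail G b) = Suc (depth (tail G a))"
      using depth[OF bC] bG b by (simp add: orientation)
    then show False using max[OF b(1)] by simp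
  qed
  ultimately have "rev_arc b = a"
    using inj_tail bG b(2) by (auto simp: tail_rev inj_on_def)
  then show False using norev a b(1) by blast
qed

section \<open>Components that do not contain the root\<close>

text \<open>An orbit in a finite set repeats, which gives a periodic \<open>w\<close>; every other
  orbit in the component meets that of \<open>w\<close>.\<close>

lemma nonroot_component_period:
  assumes C: "C \<in> sccs" and r: "r \<notin> verts C"
  obtains w n where "w \<in> verts C" "0 < n" "(succ ^^ n) w = w" "inj_on (\<lambda>k. (succ ^^ k) w) {0..<n}"
    "\<And>v. v \<in> verts C \<Longrightarrow> \<exists>m. (succ ^^ m) v = w"
proof -
  obtain u where u: "u \<in> verts C" using scc_nonempty[OF C] by auto
  have "finite (range (\<lambda>k. (succ ^^ k) u))"
    using scc_succ_funpow[OF C u] scc_verts_subset[OF C] by (intro finite_subset[OF _ finite_verts]) auto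
  then have "\<not> inj (\<lambda>k. (succ ^^ k) u)"
    using finite_imageD infinite_UNIV_nat by blast
  then obtain i j where "i < j" "(succ ^^ i) u = (succ ^^ j) u"
    unfolding inj_def by (metis nat_neq_iff)
  moreover define w where "w = (succ ^^ i) u"
  ultimately have "(succ ^^ (j - i)) w = w"
    using funpow_add[of "j - i" i succ] by simp
  then obtain n where n: "0 < n" "(succ ^^ n) w = w" "inj_on (\<lambda>k. (succ ^^ k) w) {0..<n}"
    using \<open>i < j\<close> by (auto elim: minimal_periodE[rotated])
  have w: "w \<in> verts C" unfolding w_def by (rule scc_succ_funpow[OF C u])
  have "\<exists>m. (succ ^^ m) v = w" if "v \<in> verts C" for v
  proof -
    obtain m k where mk: "(succ ^^ m) v = (succ ^^ k) w"
      using reachable_imp_orbits_meet[OF scc_reachable[OF C \<open>v \<in> verts C\<close> w]] by blast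
    \<comment> \<open>The further \<open>n * k - k\<close> steps complete the \<open>k\<close> steps
      past \<open>w\<close> to a multiple of the period.\<close>
    have "(succ ^^ (n * k - k + m)) v = (succ ^^ (n * k - k)) ((succ ^^ k) w)"
      unfolding funpow_add using mk by simp
    also have "\<dots> = (succ ^^ (n * k - k + k)) w"
      unfolding funpow_add by simp
    also have "n * k - k + k = n * k" using n(1) by simp
    also have "(succ ^^ (n * k)) w = w"
      using funpow_mod_eq[OF n(2), of "n * k"] by simp
    finally show ?thesis by blast
  qed
  then show thesis using that w n by blast
qed

text \<open>The outgoing arcs along the periodic orbit form a cycle. They all lie in
  \<open>F\<close>, so none of them is the reverse of another.\<close>

lemma nonroot_component_not_tree:
  assumes C: "C \<in> sccs" and r: "r \<notin> verts C"
  shows "\<not> undirected_tree rev_arc C"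
proof -
  obtain w n where w: "w \<in> verts C" and n: "0 < n" "(succ ^^ n) w = w"
    and inj: "inj_on (\<lambda>k. (succ ^^ k) w) {0..<n}"
    using nonroot_component_period[OF C r] by metis
  let ?v = "\<lambda>k. (succ ^^ k) w"
  define p where "p = map (\<lambda>k. out (?v k)) [0..<n]"
  have v: "?v k \<in> verts C" "?v k \<in> verts G" "?v k \<noteq> r" for k
    using scc_succ_funpow[OF C w, of k] scc_verts_subset[OF C] r by auto
  have out_v: "out (?v k) \<in> F" "tail G (out (?v k)) = ?v k" "head G (out (?v k)) = ?v (Suc k)" for k
    using out_in_F[OF v(2,3)] tail_out[OF v(2,3)] v(3)[of k] by (auto simp: succ_def)
  have "pre_digraph.cas C (?v i) (map (\<lambda>k. out (?v k)) [i..<i + j]) (?v (i + j))" for i j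
  proof (induction j arbitrary: i)
    case 0
    then show ?case by (simp add: pre_digraph.cas.simps)
  next
    case (Suc j)
    then show ?case
      using Suc[of "Suc i"] out_v[of i]
      by (simp add: upt_conv_Cons pre_digraph.cas.simps scc_tail_head[OF C] del: upt_Suc)
  qed
  from this[of 0 n] have cas: "pre_digraph.cas C w p w"
    using n by (simp add: p_def)
  moreover have "set p \<subseteq> arcs C"
    using out_v v F_subset by (auto simp: p_def scc_arcs[OF C])
  ultimately have walk: "pre_digraph.awalk C w p w"
    using w by (simp add: pre_digraph.awalk_def)
  have "tl (pre_digraph.awalk_verts C w p) = map (\<lambda>k. ?v (Suc k)) [0..<n]"
    unfolding pre_digraph.awalk_verts_conv'[OF cas]
    using n(1) out_v(3) by (simp add: p_def scc_tail_head[OF C])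
  \<comment> \<open>A cycle requires distinct vertices after the first, that is at times 1 to
    \<open>n\<close>; another \<open>n - 1\<close> steps bring these back to times 0 to
    \<open>n - 1\<close>.\<close>
  moreover have "inj_on (\<lambda>k. ?v (Suc k)) {0..<n}"
  proof (rule inj_onI)
    fix a b assume ab: "a \<in> {0..<n}" "b \<in> {0..<n}" "?v (Suc a) = ?v (Suc b)"
    have n_steps: "(succ ^^ (n - 1)) (?v (Suc k)) = ?v k" for k
    proof -
      have "(succ ^^ (n - 1)) (?v (Suc k)) = ?v (n - 1 + Suc k)" by (simp only: funpow_add comp_apply)
      also have "n - 1 + Suc k = k + n" using n(1) by simp
      finally show ?thesis using n(2) by (simp add: funpow_add)
    qed
    have "?v a = ?v b" using n_steps[of a] n_steps[of b] ab(3) by metis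
    then show "a = b" using inj ab by (auto dest: inj_onD)
  qed
  ultimately have "distinct (tl (pre_digraph.awalk_verts C w p))"
    by (simp add: distinct_map)
  then have "pre_digraph.cycle C p"
    using walk n(1) unfolding pre_digraph.cycle_def by (auto simp: p_def)
  moreover have "\<forall>a\<in>set p. rev_arc a \<notin> set p"
    using out_v(1) F_subset orientation by (auto simp: p_def image_iff) (metis subsetD)
  ultimately show ?thesis by (auto simp: undirected_tree_def)
qed

text \<open>
  Each subdivided edge is traversed in the direction of its arc in \<open>F\<close>; this makes the
  subdivision a functional graph, too, without cycles of length at most two.
\<close>

definition subdivided_succ :: "'a + 'b \<Rightarrow> 'a + 'b" where
  "subdivided_succ w = (case w of Inl v \<Rightarrow> Inr (out v)
     | Inr a \<Rightarrow> if a \<in> F then Inr (rev_arc a) else Inl (tail G a))"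

text \<open>A periodic orbit of \<open>succ\<close> may have length two, formed by parallel edges,
  so segments along \<open>succ\<close> itself could coincide. The functional graph to which the
  homotopy equivalence applies is therefore that of \<open>subdivided_succ\<close>.\<close>

lemma nonroot_component_circle:
  assumes C: "C \<in> sccs" and r: "r \<notin> verts C"
  shows "has_homotopy_type_of_circle rev_arc C"
proof -
  let ?g = subdivided_succ
  let ?W = "Inl ` verts C \<union> Inr ` arcs C"
  have vC: "v \<in> verts G" "v \<noteq> r" if "v \<in> verts C" for v
    using that scc_verts_subset[OF C] r by auto
  have outC: "out v \<in> arcs C" "out v \<in> F" "tail G (out v) = v" if "v \<in> verts C" for v
    using out_in_F[OF vC[OF that]] tail_out[OF vC[OF that]] that F_subset by (auto simp: scc_arcs[OF C])
  have arcC: "a \<in> arcs G" "tail G a \<in> verts C" if "a \<in> arcs C" for a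
    using that by (auto simp: scc_arcs[OF C])
  have "finite ?W"
    using C scc_verts_subset[OF C] finite_subset[OF _ finite_verts] by (auto simp: scc_arcs)
  have g_simps [simp]: "?g (Inl v) = Inr (out v)" "a \<in> F \<Longrightarrow> ?g (Inr a) = Inr (rev_arc a)"
    "a \<notin> F \<Longrightarrow> ?g (Inr a) = Inl (tail G a)" for v a
    by (simp_all add: subdivided_succ_def)
  have revC: "rev_arc a \<in> F \<longleftrightarrow> a \<notin> F" "rev_arc a \<noteq> a" if "a \<in> arcs C" for a
    using orientation[OF arcC(1)[OF that]] by auto
  have g_W: "?g w \<in> ?W \<and> ?g w \<noteq> w \<and> ?g (?g w) \<noteq> w" if w: "w \<in> ?W" for w
  proof -
    consider v where "v \<in> verts C" "w = Inl v" | a where "a \<in> arcs C" "a \<in> F" "w = Inr a"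
      | a where "a \<in> arcs C" "a \<notin> F" "w = Inr a"
      using w by blast
    then show ?thesis
    proof cases
      case (1 v)
      then show ?thesis using outC[of v] by simp
    next
      case (2 a)
      then show ?thesis using revC[of a] scc_rev[OF C, of a] by simp
    next
      case (3 a)
      then have "out (tail G a) \<noteq> a" using outC(2)[OF arcC(2)] by metis
      then show ?thesis using 3 arcC(2)[of a] by simp
    qed
  qed
  \<comment> \<open>The three steps pass from \<open>v\<close> through the two subdivision vertices
    of its outgoing edge to the other end.\<close>
  have three: "(?g ^^ 3) (Inl v) = Inl (succ v)" if "v \<in> verts C" for v
    using outC[OF that] arcC(1)[OF outC(1)[OF that]] vC[OF that] revC[OF outC(1)[OF that]]
    by (simp add: numeral_3_eq_3 tail_rev succ_def)
  have iter: "(?g ^^ (k * 3)) (Inl v) = Inl ((succ ^^ k) v)" if "v \<in> verts C" for v k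
  proof (induction k)
    case (Suc k)
    have "(?g ^^ (Suc k * 3)) (Inl v) = (?g ^^ 3) ((?g ^^ (k * 3)) (Inl v))"
      unfolding mult_Suc funpow_add by simp
    then show ?case using Suc three[OF scc_succ_funpow[OF C that]] by simp
  qed simp
  obtain w0 n where w0: "w0 \<in> verts C" and reach: "\<And>v. v \<in> verts C \<Longrightarrow> \<exists>m. (succ ^^ m) v = w0"
    using nonroot_component_period[OF C r] by metis
  have reach1: "\<exists>m. (?g ^^ m) (Inl v) = Inl w0" if "v \<in> verts C" for v
    using reach[OF that] iter[OF that] by metis
  have reach2: "\<exists>m. (?g ^^ m) (Inr a) = Inl w0" if "a \<in> arcs C" "a \<notin> F" for a
  proof -
    obtain m where "(?g ^^ m) (Inl (tail G a)) = Inl w0" using reach1[OF arcC(2)[OF \<open>a \<in> arcs C\<close>]] by blast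
    then have "(?g ^^ Suc m) (Inr a) = Inl w0"
      using that by (simp add: funpow_swap1)
    then show ?thesis by blast
  qed
  have reach3: "\<exists>m. (?g ^^ m) (Inr a) = Inl w0" if "a \<in> arcs C" "a \<in> F" for a
  proof -
    obtain m where "(?g ^^ m) (Inr (rev_arc a)) = Inl w0"
      using reach2[OF scc_rev[OF C \<open>a \<in> arcs C\<close>]] revC(1) \<open>a \<in> arcs C\<close> \<open>a \<in> F\<close> by blast
    then have "(?g ^^ Suc m) (Inr a) = Inl w0"
      using that by (simp add: funpow_swap1)
    then show ?thesis by blast
  qed
  have reachW: "\<exists>m. (?g ^^ m) w = Inl w0" if "w \<in> ?W" for w
    using that reach1 reach2 reach3 by blast
  \<comment> \<open>Each edge of the subdivision is traversed by \<open>?g\<close> from one of its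
    ends; membership of the arc in \<open>F\<close> decides which.\<close>
  have S1: "\<exists>w\<in>?W. s = {w} \<or> s = {w, ?g w}" if s: "s \<in> subdivision_simplices rev_arc C" for s
  proof -
    consider v where "v \<in> verts C" "s = {Inl v}"
      | a where "a \<in> arcs C" "s = {Inl (tail G a), Inr a}"
      | a where "a \<in> arcs C" "s = {Inr a, Inr (rev_arc a)}"
      using s by (auto simp: subdivision_simplices_def scc_tail_head[OF C])
    then show ?thesis
    proof cases
      case 1
      then show ?thesis by auto
    next
      case (2 a)
      have "?g (Inl (tail G a)) = Inr a \<or> ?g (Inr a) = Inl (tail G a)"
        using out_tail[of a] by (cases "a \<in> F") auto
      then have "s = {Inl (tail G a), ?g (Inl (tail G a))} \<or> s = {Inr a, ?g (Inr a)}"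
        unfolding 2(2) doubleton_eq_iff by argo
      then show ?thesis using 2(1) arcC(2)[OF 2(1)] by blast
    next
      case (3 a)
      have "?g (Inr a) = Inr (rev_arc a) \<or> ?g (Inr (rev_arc a)) = Inr a"
        using revC[OF 3(1)] rev_rev[OF arcC(1)[OF 3(1)]] by (cases "a \<in> F") auto
      then have "s = {Inr a, ?g (Inr a)} \<or> s = {Inr (rev_arc a), ?g (Inr (rev_arc a))}"
        unfolding 3(2) doubleton_eq_iff by argo
      then show ?thesis using 3(1) scc_rev[OF C 3(1)] by blast
    qed
  qed
  have S2: "{w, ?g w} \<in> subdivision_simplices rev_arc C" if "w \<in> ?W" for w
    using that
  proof
    assume "w \<in> Inl ` verts C"
    then obtain v where v: "v \<in> verts C" "w = Inl v" by auto
    then have "{w, ?g w} = {Inl (tail C (out v)), Inr (out v)}"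
      using outC by (simp add: scc_tail_head[OF C])
    then show ?thesis using outC[OF v(1)] by (auto simp: subdivision_simplices_def)
  next
    assume "w \<in> Inr ` arcs C"
    then obtain a where "a \<in> arcs C" "w = Inr a" by auto
    then show ?thesis
      by (cases "a \<in> F") (auto simp: subdivision_simplices_def scc_tail_head[OF C] insert_commute)
  qed
  have "geometric_realization rev_arc C = top_of_set (\<Union>w\<in>?W. edge_point ?g w ` {0..1})"
    unfolding geometric_realization_def
    by (intro arg_cong[where f = top_of_set] functional_complex_realization[where g = ?g] S1 S2
        g_W[THEN conjunct2, THEN conjunct1])
  moreover have "Inl w0 \<in> ?W" using w0 by blast
  then have "top_of_set (\<Union>w\<in>?W. edge_point ?g w ` {0..1})
    homotopy_equivalent_space top_of_set (sphere (0::complex) 1)"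
    using functional_graph_homotopy_circle[OF \<open>finite ?W\<close> g_W[THEN conjunct1]
        g_W[THEN conjunct2, THEN conjunct1] g_W[THEN conjunct2, THEN conjunct2] _ reachW] by blast
  ultimately show ?thesis
    by (simp add: has_homotopy_type_of_circle_def)
qed

text \<open>A component is a tree exactly if it contains \<open>r\<close>, and the components
  partition the vertices.\<close>

lemma components:
  "\<And>C. C \<in> sccs \<Longrightarrow> undirected_tree rev_arc C \<or> has_homotopy_type_of_circle rev_arc C"
  "\<exists>!C. C \<in> sccs \<and> undirected_tree rev_arc C"
proof -
  show "undirected_tree rev_arc C \<or> has_homotopy_type_of_circle rev_arc C" if "C \<in> sccs" for C
    using that root_component_tree nonroot_component_circle by blast
  have tree_iff: "undirected_tree rev_arc C \<longleftrightarrow> r \<in> verts C" if "C \<in> sccs" for C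
    using that root_component_tree nonroot_component_not_tree by blast
  have "\<exists>!C. C \<in> sccs \<and> r \<in> verts C"
  proof (rule ex_ex1I)
    show "\<exists>C. C \<in> sccs \<and> r \<in> verts C"
      using in_verts_sccsD_sccs[OF scc_of_in_sccs_verts[OF root]] in_scc_of_self[OF root]
      by (metis induce_subgraph_verts)
    show "C = C'" if "C \<in> sccs \<and> r \<in> verts C" "C' \<in> sccs \<and> r \<in> verts C'" for C C'
      using that sccs_verts_disjoint[of "verts C" "verts C'"] inj_on_verts_sccs
      by (auto simp: sccs_verts_conv inj_on_def)
  qed
  then show "\<exists>!C. C \<in> sccs \<and> undirected_tree rev_arc C"
    using tree_iff by metis
qed

end

section \<open>State subgraphs\<close>

text \<open>The first return time is the size of the orbit; this turns \<open>four_valent\<close>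
  into the statement that four rotations fix a dart.\<close>

lemma funpow_card_orbit:
  assumes "s \<in> orbit f s"
  shows "(f ^^ card (orbit f s)) s = s" "orbit f s = (\<lambda>k. (f ^^ k) s) ` {0..<card (orbit f s)}"
proof -
  have "card (orbit f s) = funpow_dist1 f s s"
    using orbit_conv_funpow_dist1[OF assms] inj_on_funpow_dist1[OF assms] by (simp add: card_image)
  then show "(f ^^ card (orbit f s)) s = s" "orbit f s = (\<lambda>k. (f ^^ k) s) ` {0..<card (orbit f s)}"
    using funpow_dist1_prop[OF assms] orbit_conv_funpow_dist1[OF assms] by simp_all
qed

context plane_four_valent_graph begin

lemma rot_in_darts: "d \<in> darts D \<Longrightarrow> rot D d \<in> darts D"
  using rot_permutes by (simp add: permutes_in_image)

lemma self_in_crossing: "d \<in> crossing D d"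
  unfolding crossing_def
  using rot_permutes finite_darts by (intro permutation_self_in_orbit) (auto simp: permutation_permutes)

lemma crossing_eq:
  assumes "e \<in> crossing D d"
  shows "crossing D e = crossing D d"
  using assms cyclic_on_orbit[OF rot_permutes finite_darts] unfolding crossing_def
  by (metis orbit_cyclic_eq3)

lemma crossing_subset_darts: "d \<in> darts D \<Longrightarrow> crossing D d \<subseteq> darts D"
  unfolding crossing_def by (rule permutes_orbit_subset[OF rot_permutes])

lemma
  assumes d: "d \<in> darts D"
  shows crossing_conv: "crossing D d = {d, rot D d, rot D (rot D d), rot D (rot D (rot D d))}"
    and opposite_corner_opposite: "opposite_corner D (opposite_corner D d) = d"
    and opposite_corner_neq: "opposite_corner D d \<noteq> d"
proof -
  have 4: "card (orbit (rot D) d) = 4" and self: "d \<in> orbit (rot D) d"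
    using four_valent[OF d] self_in_crossing[of d] by (simp_all add: crossing_def)
  have *: "{0..<4} = {0, 1, 2, 3 :: nat}" by auto
  show eq: "crossing D d = {d, rot D d, rot D (rot D d), rot D (rot D (rot D d))}"
    unfolding crossing_def using funpow_card_orbit(2)[OF self]
    by (simp add: 4 * numeral_3_eq_3 numeral_2_eq_2)
  show "opposite_corner D (opposite_corner D d) = d"
    using funpow_card_orbit(1)[OF self] by (simp add: 4 opposite_corner_def eval_nat_numeral)
  \<comment> \<open>Otherwise the four listed darts would be at most two.\<close>
  show "opposite_corner D d \<noteq> d"
    using four_valent[OF d] unfolding eq opposite_corner_def
    by (auto simp: card_insert_if split: if_splits)
qed

end

context knot_diagram begin

lemma region_rot_colour:
  assumes "S \<in> {black D, white D}" "d \<in> darts D"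
  shows "region D (rot D d) \<in> S \<longleftrightarrow> region D d \<notin> S"
  using assms black_rot[of d] rot_in_darts[of d] by (auto simp: white_def regions_def)

lemma opposite_corner_in_crossing:
  assumes "d \<in> darts D"
  shows "opposite_corner D d \<in> crossing D d"
  using crossing_conv[OF assms] by (simp add: opposite_corner_def)

lemma opposite_corner_colour:
  assumes "S \<in> {black D, white D}" "d \<in> darts D"
  shows "region D (opposite_corner D d) \<in> S \<longleftrightarrow> region D d \<in> S"
  using region_rot_colour[OF assms] region_rot_colour[OF assms(1) rot_in_darts[OF assms(2)]]
  by (simp add: opposite_corner_def)

text \<open>Colours alternate around a crossing, so the corners of one colour are two opposite
  ones.\<close>

lemma corner_colour_cases:
  assumes S: "S \<in> {black D, white D}" and d: "d \<in> darts D" and "region D d \<in> S"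
    and e: "e \<in> crossing D d" "region D e \<in> S"
  shows "e = d \<or> e = opposite_corner D d"
proof -
  have "region D (rot D d) \<notin> S" "region D (rot D (rot D (rot D d))) \<notin> S"
    using assms region_rot_colour[OF S] rot_in_darts by simp_all
  then show ?thesis
    using e crossing_conv[OF d] by (auto simp: opposite_corner_def)
qed

lemma reduced_region_inj:
  assumes "reduced_diagram D" "d \<in> darts D" "e \<in> crossing D d" "region D e = region D d"
  shows "e = d"
  using assms self_in_crossing[of d] unfolding reduced_diagram_def crossings_def
  by (auto dest: inj_onD)

text \<open>Injectivity of \<open>x\<close> recovers the crossing from a matched region, and
  reducedness then recovers the corner; together they give injectivity of tails on \<open>F\<close>.
  Every region of \<open>S\<close> other than \<open>r\<close> is matched, hence is a tail.\<close>

lemma state_subgraph_oriented: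
  assumes reduced: "reduced_diagram D" and x: "x \<in> partial_states D" "perfect_state D x"
    and S: "S \<in> {black D, white D}" and r: "S - ran x = {r}"
  shows "oriented_functional_graph (state_subgraph D S x) (opposite_corner D)
    {d \<in> darts D. region D d \<in> S \<and> x (crossing D d) = Some (region D d)} r"
proof -
  let ?G = "state_subgraph D S x"
  let ?F = "{d \<in> darts D. region D d \<in> S \<and> x (crossing D d) = Some (region D d)}"
  have G: "verts ?G = S" "tail ?G = region D" "head ?G = region D \<circ> opposite_corner D"
    "arcs ?G = {d \<in> darts D. region D d \<in> S \<and> (\<exists>s\<in>S. x (crossing D d) = Some s)}"
    by (auto simp: state_subgraph_def tait_graph_def)
  interpret G: wf_digraph ?G
    using spanning_state_subgraph[OF S, of x] by (auto simp: spanning_def subgraph_def)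
  have x_region: "\<exists>d\<in>c. s = region D d" if "x c = Some s" for c s
    using x(1) that unfolding partial_states_def by blast
  have opp: "opposite_corner D d \<in> darts D" "crossing D (opposite_corner D d) = crossing D d"
    if "d \<in> darts D" for d
    using opposite_corner_in_crossing[OF that] crossing_subset_darts[OF that] crossing_eq by blast+
  have "finite S"
    using S finite_darts black_subset finite_subset[OF black_subset] by (auto simp: white_def regions_def)
  show ?thesis
  proof
    show "finite (verts ?G)" using \<open>finite S\<close> by (simp add: G)
    show "finite (arcs ?G)" using finite_darts by (simp add: G)
    show "r \<in> verts ?G" using r by (auto simp: G)
    show "?F \<subseteq> arcs ?G" by (auto simp: G)
    show "tail ?G ` ?F = verts ?G - {r}"
    proof (intro subset_antisym subsetI)
      fix v assume "v \<in> tail ?G ` ?F"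
      then show "v \<in> verts ?G - {r}" using r by (auto simp: G intro: ranI)
    next
      fix v assume "v \<in> verts ?G - {r}"
      then have "v \<in> S" "v \<in> ran x" using r by (auto simp: G)
      then obtain c where c: "x c = Some v" by (auto simp: ran_def)
      then obtain e where e: "e \<in> darts D" "c = crossing D e"
        using x(2) by (auto simp: perfect_state_def crossings_def)
      obtain d where d: "d \<in> c" "v = region D d"
        using x_region[OF c] by blast
      then have "d \<in> darts D" "crossing D d = c"
        using e crossing_subset_darts crossing_eq by auto
      then show "v \<in> tail ?G ` ?F" using c d \<open>v \<in> S\<close> by (auto simp: G)
    qed
    show "inj_on (tail ?G) ?F"
    proof (rule inj_onI)
      fix d e assume d: "d \<in> ?F" and e: "e \<in> ?F" and eq: "tail ?G d = tail ?G e"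
      have "inj_on x (dom x)" using x(1) by (simp add: partial_states_def)
      then have "crossing D d = crossing D e"
        by (rule inj_onD) (use d e eq in \<open>auto simp: G\<close>)
      then have "d \<in> crossing D e" using self_in_crossing[of d] by simp
      then show "d = e" using reduced_region_inj[OF reduced, of e d] e eq by (simp add: G)
    qed
  next
    fix d assume d: "d \<in> arcs ?G"
    then have dD: "d \<in> darts D" "region D d \<in> S" by (auto simp: G)
    show "opposite_corner D d \<in> arcs ?G"
      using d opp opposite_corner_colour[OF S] by (simp add: G)
    show "opposite_corner D (opposite_corner D d) = d"
      by (rule opposite_corner_opposite[OF dD(1)])
    show "tail ?G (opposite_corner D d) = head ?G d"
      by (simp add: G)
    \<comment> \<open>The matched region sits at one of the two corners of this colour, and the
      regions there differ, so exactly one of the two arcs lies in \<open>?F\<close>.\<close>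
    obtain s where "s \<in> S" "x (crossing D d) = Some s" using d by (auto simp: G)
    moreover obtain e where e: "e \<in> crossing D d" "s = region D e"
      using x_region \<open>x (crossing D d) = Some s\<close> by blast
    ultimately have "e = d \<or> e = opposite_corner D d"
      using corner_colour_cases[OF S dD] by simp
    moreover have "region D (opposite_corner D d) \<noteq> region D d"
      using reduced_region_inj[OF reduced dD(1) opposite_corner_in_crossing[OF dD(1)]]
        opposite_corner_neq[OF dD(1)] by blast
    ultimately show "opposite_corner D d \<in> ?F \<longleftrightarrow> d \<notin> ?F"
      using \<open>x (crossing D d) = Some s\<close> e dD opp[OF dD(1)] opposite_corner_colour[OF S dD(1)] by auto
  qed
qed

end

theorem proposition6p7:
  fixes D :: "'d diagram" and x :: "'d set \<rightharpoonup> 'd set"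
  assumes "knot_diagram D" and "reduced_diagram D"
    and "x \<in> partial_states D" and "perfect_state D x" and "admissible_state D x"
  shows "(\<forall>S \<in> {black D, white D}. \<forall>C \<in> pre_digraph.sccs (state_subgraph D S x).
            undirected_tree (opposite_corner D) C \<or>
            has_homotopy_type_of_circle (opposite_corner D) C) \<and>
         (\<exists>!C. C \<in> pre_digraph.sccs (state_subgraph D (black D) x) \<and>
            undirected_tree (opposite_corner D) C) \<and>
         (\<exists>!C. C \<in> pre_digraph.sccs (state_subgraph D (white D) x) \<and>
            undirected_tree (opposite_corner D) C)"
proof -
  interpret knot_diagram D by fact
  obtain r s where "black D - ran x = {r}" "white D - ran x = {s}"
    using assms(5) by (auto simp: admissible_state_def card_1_singleton_iff)
  note oriented = state_subgraph_oriented[OF assms(2-4) _ this(1)]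
    state_subgraph_oriented[OF assms(2-4) _ this(2)]
  note components = oriented[THEN oriented_functional_graph.components(1)]
    oriented[THEN oriented_functional_graph.components(2)]
  show ?thesis
    using components by simp
qed

end
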